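(* Let $\eta\in\mathcal A$ have support $T\in\{T_2,T_3,\dots,T_{23}\}$. If $T\notin\{T_{14},T_{17},T_{20}\}$, then $\eta\sim_n \mathbf 1^T$. In the three remaining cases: (i) If $T=T_{14}=\{\{1,2\},\{1,3\},\{1,5\},\{1,6\}\}$, then $\eta\sim_n(1,1,1,\lambda)$ for $\lambda=\frac{\eta_{13}\eta_{16}}{\eta_{12}\eta_{15}}$. Moreover (for $\lambda,\lambda'\in\mathbb C^\times$) $(1,1,1,\lambda)\sim_n(1,1,1,\lambda')$ if and only if $\lambda=\lambda'$. (ii) If $T=T_{17}=\{\{1,2\},\{1,3\},\{1,4\},\{1,5\},\{1,6\}\}$, then $\eta\sim_n(1,\lambda,1,1,\lambda)$ for $\lambda^2=\frac{\eta_{13}\eta_{16}}{\eta_{12}\eta_{15}}$. Moreover $(1,\lambda,1,1,\lambda)\sim_n(1,\lambda',1,1,\lambda')$ if and only if $\lambda=\pm\lambda'$. (iii) If $T=T_{20}=\{\{1,j\}:2\le j\le 7\}$, then $\eta\sim_n(1,\lambda,\mu,1,\lambda,\mu)$ for $\lambda^2=\frac{\eta_{13}\eta_{16}}{\eta_{12}\eta_{15}}$ and $\mu^2=\frac{\eta_{14}\eta_{17}}{\eta_{12}\eta_{15}}$. Moreover $(1,\lambda,\mu,1,\lambda,\mu)\sim_n(1,\lambda',\mu',1,\lambda',\mu')$ if and only if $\lambda=\pm\lambda'$ and $\mu=\pm\mu'$.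
   Context: Let $I=\{1,\dots,7\}$ and write the elements of $\mathbb{Z}_2^3$ as $g_0=(0,0,0)$, $g_1=(1,0,0)$, $g_2=(0,1,0)$, $g_3=(0,0,1)$, $g_4=(1,1,1)$, $g_5=(1,1,0)$, $g_6=(1,0,1)$, $g_7=(0,1,1)$. For $i\ne j$ in $I$, $i\ast j\in I$ is the index with $g_{i\ast j}=g_i+g_j$; the lines $\{i,j,i\ast j\}$ of the Fano plane are $\{1,2,5\},\{5,6,7\},\{1,4,7\},\{1,3,6\},\{2,4,6\},\{2,3,7\},\{3,4,5\}$. Pairwise distinct $i,j,k\in I$ are called generative if $k\ne i\ast j$. Let $X=\{\{i,j\}: i,j\in I,\ i\neq j\}$. For $\eta:X\to\mathbb C$ write $\eta_{ij}=\eta(\{i,j\})$ and, for $i,j,k$ generative, $\eta_{ijk}=\eta_{i\,j\ast k}\,\eta_{jk}$. Let $\mathcal A$ be the set of maps $\eta:X\to\mathbb C$ with $\eta_{ijk}=\eta_{jki}$ for all generative $i,j,k\in I$. The support of $\eta$ is $\{t\in X:\eta(t)\neq0\}$. For $\eta,\eta'\in\mathcal A$, $\eta\sim_n\eta'$ (equivalence via normalization) means that there is a map $\alpha:I\to\mathbb C^\times$, $i\mapsto\alpha_i$, with $\eta'_{ij}=\eta_{ij}\frac{\alpha_i\alpha_j}{\alpha_{i\ast j}}$ for all $\{i,j\}\in X$. If $\eta$ has support $T=\{\{i_1,j_1\},\dots,\{i_s,j_s\}\}$ ordered lexicographically ($i_k<j_k$, $i_1\le i_2\le\dots$, and $j_k<j_{k+1}$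 if $i_k=i_{k+1}$), one writes $\eta=(\eta_{i_1j_1},\dots,\eta_{i_sj_s})$; $\mathbf 1^T=(1,\dots,1)$ is the map with value $1$ on $T$ and $0$ elsewhere. All entries of such tuples (in particular $\lambda,\lambda',\mu,\mu'$) are nonzero complex numbers. For $i,j,k$ generative, $P_{\{i,j,k\}}:=\{\{i,j\},\{j,k\},\{k,i\},\{i,j\ast k\},\{j,k\ast i\},\{k,i\ast j\}\}$. The sets $T_i$ are: $T_2=\{\{1,2\}\}$; $T_3=\{\{1,2\},\{1,3\}\}$; $T_4=\{\{1,2\},\{1,5\}\}$; $T_5=\{\{1,2\},\{6,7\}\}$; $T_6=\{\{1,2\},\{1,5\},\{2,5\}\}$; $T_7=\{\{2,5\},\{3,6\},\{4,7\}\}$; $T_8=\{\{1,2\},\{1,3\},\{1,4\}\}$; $T_9=\{\{1,2\},\{1,3\},\{1,5\}\}$; $T_{10}=\{\{1,2\},\{1,3\},\{1,7\}\}$; $T_{11}=\{\{1,2\},\{1,6\},\{2,6\}\}$; $T_{12}=\{\{1,2\},\{1,6\},\{6,7\}\}$; $T_{13}=\{\{1,2\},\{1,3\},\{1,4\},\{1,5\}\}$; $T_{14}=\{\{1,2\},\{1,3\},\{1,5\},\{1,6\}\}$; $T_{15}=\{\{1,2\},\{1,6\},\{1,7\},\{2,6\}\}$; $T_{16}=\{\{1,2\},\{1,6\},\{2,7\},\{6,7\}\}$; $T_{17}=\{\{1,2\},\{1,3\},\{1,4\},\{1,5\},\{1,6\}\}$; $T_{18}=\{\{1,2\},\{1,6\},\{1,7\},\{2,6\},\{2,7\}\}$;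 $T_{19}=\{\{3,4\},\{3,6\},\{3,7\},\{4,6\},\{4,7\},\{6,7\}\}$; $T_{20}=\{\{1,j\}:2\le j\le7\}$; $T_{21}=P_{\{1,2,3\}}$; $T_{22}=P_{\{1,2,3\}}\cup P_{\{1,2,6\}}\cup P_{\{1,3,5\}}\cup P_{\{1,5,6\}}$; $T_{23}=X\setminus T_{19}$. *)

theory Defs
  imports Complex_Main "HOL-Library.Z2" "HOL-Library.Product_Plus" "HOL-Library.FuncSet"
begin

definition I :: "nat set" where
  "I = {1..7}"

definition g :: "nat \<Rightarrow> bit \<times> bit \<times> bit" where
  "g i = [(0,0,0), (1,0,0), (0,1,0), (0,0,1), (1,1,1), (1,1,0), (1,0,1), (0,1,1)] ! i"

text \<open>Only meaningful for distinct \<open>i\<close>, \<open>j\<close> in \<open>I\<close>.\<close>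

definition star :: "nat \<Rightarrow> nat \<Rightarrow> nat"  (infixl "\<star>" 70) where
  "i \<star> j = (THE k. k \<in> I \<and> g k = g i + g j)"

definition generative :: "nat \<Rightarrow> nat \<Rightarrow> nat \<Rightarrow> bool" where
  "generative i j k \<longleftrightarrow>
     i \<in> I \<and> j \<in> I \<and> k \<in> I \<and> i \<noteq> j \<and> j \<noteq> k \<and> i \<noteq> k \<and> k \<noteq> i \<star> j"

definition X :: "nat set set" where
  "X = {{i, j} | i j. i \<in> I \<and> j \<in> I \<and> i \<noteq> j}"

definition triple :: "(nat set \<Rightarrow> complex) \<Rightarrow> nat \<Rightarrow> nat \<Rightarrow> nat \<Rightarrow> complex" where
  "triple \<eta> i j k = \<eta> {i, j \<star> k} * \<eta> {j, k}"

text \<open>A map from \<open>X\<close> to the complex numbers is an extensional function: it takes the value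
  \<open>undefined\<close> outside \<open>X\<close>.\<close>

definition \<A> :: "(nat set \<Rightarrow> complex) set" where
  "\<A> = {\<eta> \<in> X \<rightarrow>\<^sub>E UNIV. \<forall>i j k. generative i j k \<longrightarrow> triple \<eta> i j k = triple \<eta> j k i}"

definition support :: "(nat set \<Rightarrow> complex) \<Rightarrow> nat set set" where
  "support \<eta> = {t \<in> X. \<eta> t \<noteq> 0}"

definition norm_equiv :: "(nat set \<Rightarrow> complex) \<Rightarrow> (nat set \<Rightarrow> complex) \<Rightarrow> bool"
    (infix "\<sim>\<^sub>n" 50) where
  "\<eta> \<sim>\<^sub>n \<eta>' \<longleftrightarrow> \<eta> \<in> \<A> \<and> \<eta>' \<in> \<A> \<and>
     (\<exists>\<alpha> :: nat \<Rightarrow> complex. (\<forall>i\<in>I. \<alpha> i \<noteq> 0) \<and>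
        (\<forall>i\<in>I. \<forall>j\<in>I. i \<noteq> j \<longrightarrow> \<eta>' {i, j} = \<eta> {i, j} * (\<alpha> i * \<alpha> j / \<alpha> (i \<star> j))))"

text \<open>The elements of a subset of \<open>X\<close>, in the lexicographic order of the pairs
  \<open>(i, j)\<close> with \<open>i < j\<close>.\<close>

definition lex_list :: "nat set set \<Rightarrow> nat set list" where
  "lex_list T = [{i, j}. i \<leftarrow> [1..<8], j \<leftarrow> [i+1..<8], {i, j} \<in> T]"

text \<open>\<open>tuple T cs\<close> is the map with support \<open>T\<close> that is written as the tuple \<open>cs\<close>; this presupposes
  \<open>T \<subseteq> X\<close>, \<open>length cs = card T\<close> and nonzero entries.\<close>

definition tuple :: "nat set set \<Rightarrow> complex list \<Rightarrow> nat set \<Rightarrow> complex" where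
  "tuple T cs =
     (\<lambda>t\<in>X. case map_of (zip (lex_list T) cs) t of Some c \<Rightarrow> c | None \<Rightarrow> 0)"

definition one_on :: "nat set set \<Rightarrow> nat set \<Rightarrow> complex" where
  "one_on T = (\<lambda>t\<in>X. if t \<in> T then 1 else 0)"

definition P :: "nat \<Rightarrow> nat \<Rightarrow> nat \<Rightarrow> nat set set" where
  "P i j k = {{i, j}, {j, k}, {k, i}, {i, j \<star> k}, {j, k \<star> i}, {k, i \<star> j}}"

definition T2 :: "nat set set" where "T2 = {{1,2}}"
definition T3 :: "nat set set" where "T3 = {{1,2}, {1,3}}"
definition T4 :: "nat set set" where "T4 = {{1,2}, {1,5}}"
definition T5 :: "nat set set" where "T5 = {{1,2}, {6,7}}"
definition T6 :: "nat set set" where "T6 = {{1,2}, {1,5}, {2,5}}"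
definition T7 :: "nat set set" where "T7 = {{2,5}, {3,6}, {4,7}}"
definition T8 :: "nat set set" where "T8 = {{1,2}, {1,3}, {1,4}}"
definition T9 :: "nat set set" where "T9 = {{1,2}, {1,3}, {1,5}}"
definition T10 :: "nat set set" where "T10 = {{1,2}, {1,3}, {1,7}}"
definition T11 :: "nat set set" where "T11 = {{1,2}, {1,6}, {2,6}}"
definition T12 :: "nat set set" where "T12 = {{1,2}, {1,6}, {6,7}}"
definition T13 :: "nat set set" where "T13 = {{1,2}, {1,3}, {1,4}, {1,5}}"
definition T14 :: "nat set set" where "T14 = {{1,2}, {1,3}, {1,5}, {1,6}}"
definition T15 :: "nat set set" where "T15 = {{1,2}, {1,6}, {1,7}, {2,6}}"
definition T16 :: "nat set set" where "T16 = {{1,2}, {1,6}, {2,7}, {6,7}}"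
definition T17 :: "nat set set" where "T17 = {{1,2}, {1,3}, {1,4}, {1,5}, {1,6}}"
definition T18 :: "nat set set" where "T18 = {{1,2}, {1,6}, {1,7}, {2,6}, {2,7}}"
definition T19 :: "nat set set" where "T19 = {{3,4}, {3,6}, {3,7}, {4,6}, {4,7}, {6,7}}"
definition T20 :: "nat set set" where "T20 = {{1, j} | j. 2 \<le> j \<and> j \<le> 7}"
definition T21 :: "nat set set" where "T21 = P 1 2 3"
definition T22 :: "nat set set" where "T22 = P 1 2 3 \<union> P 1 2 6 \<union> P 1 3 5 \<union> P 1 5 6"
definition T23 :: "nat set set" where "T23 = X - T19"

end

theory Submission
  imports Defs
begin

text \<open>Normalizing \<open>\<eta>\<close> to \<open>one_on T\<close> means solving the multiplicative system
  \<open>\<eta> {i, j} * \<alpha> i * \<alpha> j = \<alpha> (i \<star> j)\<close>, one equation for each edge of \<open>T\<close>. Since nonzero complex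
  numbers have square roots, the system is solvable for arbitrary nonzero \<open>\<eta>\<close> when its exponent
  matrix has independent rows, and all but six of the sets lie in one of seven such sets. For \<open>T21\<close>,
  \<open>T22\<close> and \<open>T23\<close> the rows are dependent, but the relations of \<open>\<A>\<close> express the remaining values
  through an independent family of edges. The sets \<open>T14\<close>, \<open>T17\<close> and \<open>T20\<close> consist of edges
  through \<open>1\<close>, where \<open>\<A>\<close> imposes no relation; here \<open>\<alpha>\<close> acts on the two values on a line
  \<open>{1, i, j}\<close> by \<open>(x, y) \<mapsto> (x * a * b, y * a / b)\<close> with \<open>a = \<alpha> 1\<close> and \<open>b = \<alpha> i / \<alpha> j\<close>, so that
  the quotients of the products \<open>x * y\<close> for different lines are invariant.\<close>

text \<open>Keeps the index \<open>1\<close> from being rewritten to \<open>Suc 0\<close>.\<close>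

declare One_nat_def [simp del]

subsection \<open>The Fano plane\<close>

lemma I_eq: "I = {1, 2, 3, 4, 5, 6, 7}"
  unfolding I_def by auto

lemma g_simps [simp]:
  "g 1 = (1,0,0)" "g 2 = (0,1,0)" "g 3 = (0,0,1)" "g 4 = (1,1,1)"
  "g 5 = (1,1,0)" "g 6 = (1,0,1)" "g 7 = (0,1,1)"
  by (simp_all add: g_def nth_Cons')

lemma g_eq_iff: "i \<in> I \<Longrightarrow> j \<in> I \<Longrightarrow> g i = g j \<longleftrightarrow> i = j"
  unfolding I_eq by auto

lemma star_eqI: "k \<in> I \<Longrightarrow> g k = g i + g j \<Longrightarrow> i \<star> j = k"
  unfolding star_def by (rule the_equality) (auto simp flip: g_eq_iff)

lemma star_commute: "i \<star> j = j \<star> i"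
  by (simp add: star_def add.commute)

lemma star_table [simp]:
  "1 \<star> 2 = 5" "1 \<star> 3 = 6" "1 \<star> 4 = 7" "1 \<star> 5 = 2" "1 \<star> 6 = 3" "1 \<star> 7 = 4"
  "2 \<star> 3 = 7" "2 \<star> 4 = 6" "2 \<star> 5 = 1" "2 \<star> 6 = 4" "2 \<star> 7 = 3"
  "3 \<star> 4 = 5" "3 \<star> 5 = 4" "3 \<star> 6 = 1" "3 \<star> 7 = 2"
  "4 \<star> 5 = 3" "4 \<star> 6 = 2" "4 \<star> 7 = 1"
  "5 \<star> 6 = 7" "5 \<star> 7 = 6" "6 \<star> 7 = 5"
  by (rule star_eqI; simp add: I_eq)+

lemmas star_table_commuted [simp] = star_table [THEN trans [OF star_commute]]

lemma star_in_I: "i \<in> I \<Longrightarrow> j \<in> I \<Longrightarrow> i \<noteq> j \<Longrightarrow> i \<star> j \<in> I"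
  unfolding I_eq by (elim insertE emptyE) simp_all

lemma g_star: "i \<in> I \<Longrightarrow> j \<in> I \<Longrightarrow> i \<noteq> j \<Longrightarrow> g (i \<star> j) = g i + g j"
  unfolding I_eq by (elim insertE emptyE) simp_all

lemma star_left_neq: "i \<in> I \<Longrightarrow> j \<in> I \<Longrightarrow> i \<noteq> j \<Longrightarrow> i \<star> j \<noteq> i"
  unfolding I_eq by (elim insertE emptyE) simp_all

lemma star_star_cancel: "i \<in> I \<Longrightarrow> j \<in> I \<Longrightarrow> i \<noteq> j \<Longrightarrow> (i \<star> j) \<star> j = i"
  unfolding I_eq by (elim insertE emptyE) simp_all

lemma generative_rotate:
  assumes "generative i j k" shows "generative j k i"
proof -
  \<comment> \<open>If \<open>i\<close> were \<open>j \<star> k\<close>, cancelling \<open>j\<close>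
    would give \<open>k = i \<star> j\<close>, which \<open>generative\<close> excludes.\<close>
  have "k \<star> j \<star> j = k" using assms by (intro star_star_cancel) (auto simp: generative_def)
  with assms have "i \<noteq> j \<star> k" by (auto simp: generative_def star_commute [of j])
  with assms show ?thesis by (auto simp: generative_def)
qed

lemma generative_neq: "generative i j k \<Longrightarrow> i \<noteq> j \<star> k"
  using generative_rotate [of i j k] by (simp add: generative_def)

text \<open>Both sides are the index of the same vector \<open>g i + g j + g k\<close>.\<close>

lemma star_rotate:
  assumes "generative i j k" shows "i \<star> (j \<star> k) = j \<star> (k \<star> i)"
  using assms unfolding generative_def star_def [of i] star_def [of j "_ \<star> _"]
  by (simp add: g_star ac_simps)

lemma edge_in_X [simp]: "{i, j} \<in> X \<longleftrightarrow> i \<in> I \<and> j \<in> I \<and> i \<noteq> j"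
  unfolding X_def by (auto simp: doubleton_eq_iff)

lemma triple_rotate: "\<eta> \<in> \<A> \<Longrightarrow> generative i j k \<Longrightarrow> triple \<eta> i j k = triple \<eta> j k i"
  unfolding \<A>_def by blast

lemmas A_rotate = triple_rotate [unfolded triple_def]

subsection \<open>Criteria for equivalence via normalization\<close>

text \<open>Under normalization both sides of the defining relation of \<open>\<A>\<close> are multiplied by
  \<open>\<alpha> i * \<alpha> j * \<alpha> k / \<alpha> (i \<star> (j \<star> k))\<close>, hence membership of \<open>\<eta>'\<close> comes for free.\<close>

lemma norm_equivI:
  assumes A: "\<eta> \<in> \<A>" and ext: "\<eta>' \<in> X \<rightarrow>\<^sub>E UNIV" and nz: "\<And>i. i \<in> I \<Longrightarrow> \<alpha> i \<noteq> 0"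
    and supp: "support \<eta> \<subseteq> T" "support \<eta>' \<subseteq> T"
    and scale: "\<And>i j. i \<in> I \<Longrightarrow> j \<in> I \<Longrightarrow> i < j \<Longrightarrow> {i, j} \<in> T \<Longrightarrow>
      \<eta>' {i, j} * \<alpha> (i \<star> j) = \<eta> {i, j} * (\<alpha> i * \<alpha> j)"
  shows "\<eta> \<sim>\<^sub>n \<eta>'"
proof -
  have lt: "\<eta>' {i, j} = \<eta> {i, j} * (\<alpha> i * \<alpha> j / \<alpha> (i \<star> j))"
    if "i \<in> I" "j \<in> I" "i < j" for i j
  proof (cases "{i, j} \<in> T")
    case True
    then show ?thesis
      using scale [OF that] nz [OF star_in_I [of i j]] that by (simp add: field_simps)
  next
    case False
    with supp have "{i, j} \<notin> support \<eta>" "{i, j} \<notin> support \<eta>'" by auto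
    with that have "\<eta> {i, j} = 0" "\<eta>' {i, j} = 0" by (simp_all add: support_def)
    then show ?thesis by simp
  qed
  have *: "\<eta>' {i, j} = \<eta> {i, j} * (\<alpha> i * \<alpha> j / \<alpha> (i \<star> j))"
    if "i \<in> I" "j \<in> I" "i \<noteq> j" for i j
  proof (cases "i < j")
    case True
    with lt that show ?thesis by blast
  next
    case False
    with lt [of j i] that show ?thesis
      by (simp add: insert_commute star_commute [of i] mult.commute [of "\<alpha> i"])
  qed
  have triple: "triple \<eta>' i j k = triple \<eta> i j k * (\<alpha> i * \<alpha> j * \<alpha> k / \<alpha> (i \<star> (j \<star> k)))"
    if "generative i j k" for i j k
    using that generative_neq [OF that] nz [OF star_in_I [of j k]]
    by (simp add: triple_def * [of i "j \<star> k"] * [of j k] star_in_I generative_def)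
  have "triple \<eta>' i j k = triple \<eta>' j k i" if "generative i j k" for i j k
    using triple [OF that] triple [OF generative_rotate [OF that]]
    by (simp add: star_rotate [OF that] triple_rotate [OF A that] ac_simps)
  then have "\<eta>' \<in> \<A>" using ext unfolding \<A>_def by blast
  with A nz * show ?thesis unfolding norm_equiv_def by blast
qed

lemma norm_equiv_one_onI:
  assumes "\<eta> \<in> \<A>" "support \<eta> = T" "\<And>i. i \<in> I \<Longrightarrow> \<alpha> i \<noteq> 0"
    and "\<And>i j. i \<in> I \<Longrightarrow> j \<in> I \<Longrightarrow> i < j \<Longrightarrow> {i, j} \<in> T \<Longrightarrow>
      \<eta> {i, j} * (\<alpha> i * \<alpha> j) = \<alpha> (i \<star> j)"
  shows "\<eta> \<sim>\<^sub>n one_on T"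
  using assms
  by (intro norm_equivI [where \<alpha> = \<alpha> and T = T])
    (auto simp: one_on_def support_def split: if_splits)

text \<open>Orienting each edge as an ordered pair in an explicit set \<open>E\<close> reduces the
  scaling condition to one equation per edge, in place of a case analysis over all pairs of indices.
  This matters for the larger supports.\<close>

lemma norm_equiv_edgesI:
  assumes "\<eta> \<in> \<A>" "\<eta>' \<in> X \<rightarrow>\<^sub>E UNIV" "support \<eta> \<subseteq> T" "support \<eta>' \<subseteq> T"
    and T: "T = (\<lambda>(i, j). {i, j}) ` E" and nz: "\<And>i. i \<in> I \<Longrightarrow> \<alpha> i \<noteq> 0"
    and E: "\<forall>(i, j)\<in>E. \<eta>' {i, j} * \<alpha> (i \<star> j) = \<eta> {i, j} * (\<alpha> i * \<alpha> j)"
  shows "\<eta> \<sim>\<^sub>n \<eta>'"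
proof (rule norm_equivI [where \<alpha> = \<alpha> and T = T])
  fix i j assume "{i, j} \<in> T"
  then have "(i, j) \<in> E \<or> (j, i) \<in> E" using T by (auto simp: doubleton_eq_iff)
  then show "\<eta>' {i, j} * \<alpha> (i \<star> j) = \<eta> {i, j} * (\<alpha> i * \<alpha> j)"
  proof
    assume "(j, i) \<in> E"
    with E have "\<eta>' {j, i} * \<alpha> (j \<star> i) = \<eta> {j, i} * (\<alpha> j * \<alpha> i)" by blast
    then show ?thesis
      by (simp only: insert_commute [of j] star_commute [of j] mult.commute [of "\<alpha> j"])
  qed (use E in blast)
qed (use assms in auto)

lemma norm_equiv_one_on_edgesI:
  assumes "\<eta> \<in> \<A>" "support \<eta> = T" and T: "T = (\<lambda>(i, j). {i, j}) ` E"
    and nz: "\<And>i. i \<in> I \<Longrightarrow> \<alpha> i \<noteq> 0"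
    and E: "\<forall>(i, j)\<in>E. \<eta> {i, j} * (\<alpha> i * \<alpha> j) = \<alpha> (i \<star> j)"
  shows "\<eta> \<sim>\<^sub>n one_on T"
proof (rule norm_equiv_edgesI [OF assms(1) _ _ _ T nz])
  have "one_on T {i, j} = 1" if "(i, j) \<in> E" for i j
  proof -
    have "{i, j} \<in> T" using T that by blast
    moreover have "{i, j} \<in> X" using calculation assms(2) unfolding support_def by blast
    ultimately show ?thesis by (simp add: one_on_def)
  qed
  then show "\<forall>(i, j)\<in>E. one_on T {i, j} * \<alpha> (i \<star> j) = \<eta> {i, j} * (\<alpha> i * \<alpha> j)"
    using E by auto
qed (use assms(2) in \<open>auto simp: one_on_def support_def split: if_splits\<close>)

text \<open>Turns a map with zeros into one that vanishes nowhere, without changing it on its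
  support.\<close>

definition unit_part :: "complex \<Rightarrow> complex" where
  "unit_part z = (if z = 0 then 1 else z)"

lemma unit_part_nonzero [simp]: "unit_part z \<noteq> 0"
  by (simp add: unit_part_def)

text \<open>Being quantified over all nonzero \<open>c\<close>, this passes to subsets of \<open>T\<close>, so that only the
  maximal such sets need to be treated.\<close>

definition normalizable :: "nat set set \<Rightarrow> bool" where
  "normalizable T \<longleftrightarrow> (\<forall>c. (\<forall>t. c t \<noteq> 0) \<longrightarrow>
     (\<exists>\<alpha> :: nat \<Rightarrow> complex. (\<forall>i. \<alpha> i \<noteq> 0) \<and>
       (\<forall>i\<in>I. \<forall>j\<in>I. i < j \<longrightarrow> {i, j} \<in> T \<longrightarrow> c {i, j} * (\<alpha> i * \<alpha> j) = \<alpha> (i \<star> j))))"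

text \<open>Filling the zeros of \<open>\<eta>\<close> with \<open>1\<close> gives a system on all
  of \<open>T\<close>; its solution satisfies in particular the equations for the edges in the
  support.\<close>

lemma normalizable_norm_equiv:
  assumes "normalizable T" "\<eta> \<in> \<A>" "support \<eta> \<subseteq> T"
  shows "\<eta> \<sim>\<^sub>n one_on (support \<eta>)"
proof -
  from assms(1) [unfolded normalizable_def, rule_format, of "\<lambda>t. unit_part (\<eta> t)"]
  obtain \<alpha> where \<alpha>: "\<forall>i. \<alpha> i \<noteq> 0" "\<forall>i\<in>I. \<forall>j\<in>I. i < j \<longrightarrow> {i, j} \<in> T \<longrightarrow>
      unit_part (\<eta> {i, j}) * (\<alpha> i * \<alpha> j) = \<alpha> (i \<star> j)"
    by auto
  show ?thesis
  proof (rule norm_equiv_one_onI [OF assms(2) refl, of \<alpha>])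
    fix i j assume *: "i \<in> I" "j \<in> I" "i < j" "{i, j} \<in> support \<eta>"
    then have "unit_part (\<eta> {i, j}) = \<eta> {i, j}" by (simp add: unit_part_def support_def)
    moreover have "{i, j} \<in> T" using * assms(3) by blast
    ultimately show "\<eta> {i, j} * (\<alpha> i * \<alpha> j) = \<alpha> (i \<star> j)" using * \<alpha>(2) by metis
  qed (use \<alpha> in simp)
qed

subsection \<open>Supports that can be normalized to \<open>1\<close>\<close>

text \<open>Here \<open>r\<close> is a square root of \<open>a * b\<close>. The form
  \<open>b = r\<^sup>2 / a\<close> lets \<open>b\<close> be eliminated, so that only rational
  identities in \<open>r\<close> and the other values remain.\<close>

lemma square_over:
  fixes a b :: complex
  assumes "a \<noteq> 0" "b \<noteq> 0"
  shows "\<exists>r. r \<noteq> 0 \<and> b = r\<^sup>2 / a"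
  using assms by (intro exI [of _ "csqrt (a * b)"]) simp

lemma normalizable_T6: "normalizable T6"
  unfolding normalizable_def
proof (intro allI impI)
  fix c :: "nat set \<Rightarrow> complex" assume c [simp]: "\<forall>t. c t \<noteq> 0"
  \<comment> \<open>The product of the equations for \<open>{1,2}\<close> and \<open>{1,5}\<close>
    forces the square of \<open>\<alpha> 1\<close> to be \<open>1 / (c {1,2} * c {1,5})\<close>. The
    edges \<open>{1,2}\<close> and \<open>{2,5}\<close> fix the square of \<open>\<alpha> 2\<close>
    in the same way.\<close>
  obtain r where r: "r \<noteq> 0" "c {1,5} = r\<^sup>2 / c {1,2}"
    using square_over [of "c {1,2}" "c {1,5}"] by auto
  obtain s where s: "s \<noteq> 0" "c {2,5} = s\<^sup>2 / c {1,2}"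
    using square_over [of "c {1,2}" "c {2,5}"] by auto
  show "\<exists>\<alpha>. (\<forall>i. \<alpha> i \<noteq> 0) \<and>
    (\<forall>i\<in>I. \<forall>j\<in>I. i < j \<longrightarrow> {i, j} \<in> T6 \<longrightarrow> c {i, j} * (\<alpha> i * \<alpha> j) = \<alpha> (i \<star> j))"
    using r s
    by (intro exI [of _ "(\<lambda>_. 1)(1 := 1 / r, 2 := 1 / s, 5 := c {1,2} / (r * s))"])
      (auto simp: T6_def doubleton_eq_iff field_simps power2_eq_square)
qed

text \<open>All three edges have third point \<open>1\<close>, and each contains exactly one of the
  points \<open>5\<close>, \<open>6\<close>, \<open>7\<close>, whose value absorbs the
  coefficient.\<close>

lemma normalizable_T7: "normalizable T7"
  unfolding normalizable_def
proof (intro allI impI)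
  fix c :: "nat set \<Rightarrow> complex" assume c [simp]: "\<forall>t. c t \<noteq> 0"
  show "\<exists>\<alpha>. (\<forall>i. \<alpha> i \<noteq> 0) \<and>
    (\<forall>i\<in>I. \<forall>j\<in>I. i < j \<longrightarrow> {i, j} \<in> T7 \<longrightarrow> c {i, j} * (\<alpha> i * \<alpha> j) = \<alpha> (i \<star> j))"
    by (intro exI [of _ "(\<lambda>_. 1)(5 := 1 / c {2,5}, 6 := 1 / c {3,6}, 7 := 1 / c {4,7})"])
      (auto simp: T7_def doubleton_eq_iff)
qed

text \<open>The third points \<open>5\<close>, \<open>6\<close>, \<open>4\<close> are distinct and
  lie on no edge of \<open>T10\<close>, so each equation is solved by itself.\<close>

lemma normalizable_T10: "normalizable T10"
  unfolding normalizable_def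
proof (intro allI impI)
  fix c :: "nat set \<Rightarrow> complex" assume c [simp]: "\<forall>t. c t \<noteq> 0"
  show "\<exists>\<alpha>. (\<forall>i. \<alpha> i \<noteq> 0) \<and>
    (\<forall>i\<in>I. \<forall>j\<in>I. i < j \<longrightarrow> {i, j} \<in> T10 \<longrightarrow> c {i, j} * (\<alpha> i * \<alpha> j) = \<alpha> (i \<star> j))"
    by (intro exI [of _ "(\<lambda>_. 1)(5 := c {1,2}, 6 := c {1,3}, 4 := c {1,7})"])
      (auto simp: T10_def doubleton_eq_iff)
qed

lemma normalizable_T13: "normalizable T13"
  unfolding normalizable_def
proof (intro allI impI)
  fix c :: "nat set \<Rightarrow> complex" assume c [simp]: "\<forall>t. c t \<noteq> 0"
  \<comment> \<open>Only the line \<open>{1,2,5}\<close> contributes two edges; these fix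
    \<open>\<alpha> 1\<close> up to sign.\<close>
  obtain r where r: "r \<noteq> 0" "c {1,5} = r\<^sup>2 / c {1,2}"
    using square_over [of "c {1,2}" "c {1,5}"] by auto
  show "\<exists>\<alpha>. (\<forall>i. \<alpha> i \<noteq> 0) \<and>
    (\<forall>i\<in>I. \<forall>j\<in>I. i < j \<longrightarrow> {i, j} \<in> T13 \<longrightarrow> c {i, j} * (\<alpha> i * \<alpha> j) = \<alpha> (i \<star> j))"
    using r
    by (intro exI [of _ "(\<lambda>_. 1)(1 := 1 / r, 5 := c {1,2} / r, 6 := c {1,3} / r,
          7 := c {1,4} / r)"])
      (auto simp: T13_def doubleton_eq_iff field_simps power2_eq_square)
qed

lemma normalizable_T16: "normalizable T16"
  unfolding normalizable_def
proof (intro allI impI)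
  fix c :: "nat set \<Rightarrow> complex" assume c [simp]: "\<forall>t. c t \<noteq> 0"
  \<comment> \<open>With \<open>\<alpha> 1 = \<alpha> 2 = 1\<close>, the first three equations
    express everything through \<open>\<alpha> 6\<close>; the one for \<open>{6,7}\<close> then
    becomes quadratic in \<open>\<alpha> 6\<close>, with solution \<open>1 / r\<close>.\<close>
  obtain r where r: "r \<noteq> 0" "c {6,7} = r\<^sup>2 / (c {1,6} / (c {1,2} * c {2,7}))"
    using square_over [of "(c {1,6} / (c {1,2} * c {2,7}))" "c {6,7}"] by auto
  show "\<exists>\<alpha>. (\<forall>i. \<alpha> i \<noteq> 0) \<and>
    (\<forall>i\<in>I. \<forall>j\<in>I. i < j \<longrightarrow> {i, j} \<in> T16 \<longrightarrow> c {i, j} * (\<alpha> i * \<alpha> j) = \<alpha> (i \<star> j))"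
    using r
    by (intro exI [of _ "(\<lambda>_. 1)(3 := c {1,6} / r, 5 := c {1,2}, 6 := 1 / r,
          7 := c {1,6} / (r * c {2,7}))"])
      (auto simp: T16_def doubleton_eq_iff field_simps power2_eq_square)
qed

lemma normalizable_T18: "normalizable T18"
  unfolding normalizable_def
proof (intro allI impI)
  fix c :: "nat set \<Rightarrow> complex" assume c [simp]: "\<forall>t. c t \<noteq> 0"
  \<comment> \<open>With \<open>\<alpha> 1 = \<alpha> 6 = 1\<close>, the other values depend on
    \<open>\<alpha> 2\<close>, and the equation for \<open>{2,7}\<close> fixes its square.\<close>
  obtain r where r: "r \<noteq> 0" "c {2,7} = r\<^sup>2 / (c {2,6} / (c {1,6} * c {1,7}))"
    using square_over [of "(c {2,6} / (c {1,6} * c {1,7}))" "c {2,7}"] by auto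
  show "\<exists>\<alpha>. (\<forall>i. \<alpha> i \<noteq> 0) \<and>
    (\<forall>i\<in>I. \<forall>j\<in>I. i < j \<longrightarrow> {i, j} \<in> T18 \<longrightarrow> c {i, j} * (\<alpha> i * \<alpha> j) = \<alpha> (i \<star> j))"
    using r
    by (intro exI [of _ "(\<lambda>_. 1)(2 := 1 / r, 3 := c {1,6}, 4 := c {2,6} / r,
          5 := c {1,2} / r, 7 := c {2,6} / (r * c {1,7}))"])
      (auto simp: T18_def doubleton_eq_iff field_simps power2_eq_square)
qed

lemma normalizable_T19: "normalizable T19"
  unfolding normalizable_def
proof (intro allI impI)
  fix c :: "nat set \<Rightarrow> complex" assume c [simp]: "\<forall>t. c t \<noteq> 0"
  \<comment> \<open>With \<open>\<alpha> 3 = 1\<close>, the other values depend on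
    \<open>\<alpha> 4\<close> and \<open>\<alpha> 7\<close>, whose squares are fixed by the
    equations for \<open>{4,6}\<close> and \<open>{6,7}\<close>.\<close>
  obtain r where r: "r \<noteq> 0" "c {4,6} = r\<^sup>2 / (c {4,7} / (c {3,6} * c {3,7}))"
    using square_over [of "(c {4,7} / (c {3,6} * c {3,7}))" "c {4,6}"] by auto
  obtain s where s: "s \<noteq> 0" "c {6,7} = s\<^sup>2 / (c {4,7} / (c {3,4} * c {3,6}))"
    using square_over [of "(c {4,7} / (c {3,4} * c {3,6}))" "c {6,7}"] by auto
  show "\<exists>\<alpha>. (\<forall>i. \<alpha> i \<noteq> 0) \<and>
    (\<forall>i\<in>I. \<forall>j\<in>I. i < j \<longrightarrow> {i, j} \<in> T19 \<longrightarrow> c {i, j} * (\<alpha> i * \<alpha> j) = \<alpha> (i \<star> j))"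
    using r s
    by (intro exI [of _ "(\<lambda>_. 1)(1 := c {4,7} / (r * s), 2 := c {3,7} / s, 4 := 1 / r,
          5 := c {3,4} / r, 6 := c {4,7} / (r * s * c {3,6}), 7 := 1 / s)"])
      (auto simp: T19_def doubleton_eq_iff field_simps power2_eq_square)
qed

section \<open>Supports on which the relations of \<open>\<A>\<close> tie the values
  together\<close>

lemma norm_equiv_T21:
  assumes A: "\<eta> \<in> \<A>" and supp: "support \<eta> = T21"
  shows "\<eta> \<sim>\<^sub>n one_on T21"
proof -
  have T: "T21 = {{1,2}, {1,3}, {1,7}, {2,3}, {2,6}, {3,5}}"
    by (simp add: T21_def P_def insert_commute)
  have "\<forall>t\<in>T21. \<eta> t \<noteq> 0" using supp by (auto simp: support_def)
  \<comment> \<open>These four edges are the independent family; \<alpha> is solved from them, and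
    \<open>*\<close> makes the other two equations automatic.\<close>
  then have [simp]: "\<eta> {1,2} \<noteq> 0" "\<eta> {1,3} \<noteq> 0" "\<eta> {1,7} \<noteq> 0" "\<eta> {2,3} \<noteq> 0"
    by (simp_all add: T)
  have "\<eta> {1,7} * \<eta> {2,3} = \<eta> {2,6} * \<eta> {1,3}" "\<eta> {2,6} * \<eta> {1,3} = \<eta> {3,5} * \<eta> {1,2}"
    using A_rotate [OF A, of 1 2 3] A_rotate [OF A, of 2 3 1]
    by (simp_all add: generative_def I_eq insert_commute)
  then have *: "\<eta> {2,6} = \<eta> {1,7} * \<eta> {2,3} / \<eta> {1,3}" "\<eta> {3,5} = \<eta> {1,7} * \<eta> {2,3} / \<eta> {1,2}"
    by (simp_all add: field_simps)
  show ?thesis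
    by (rule norm_equiv_one_on_edgesI [OF A supp, where
          E = "{(1,2), (1,3), (1,7), (2,3), (2,6), (3,5)}"
          and \<alpha> = "(\<lambda>_. 1)(4 := \<eta> {1,7} * \<eta> {2,3},
          5 := \<eta> {1,2}, 6 := \<eta> {1,3}, 7 := \<eta> {2,3})"])
      (simp_all add: T *)
qed

lemma norm_equiv_T22:
  assumes A: "\<eta> \<in> \<A>" and supp: "support \<eta> = T22"
  shows "\<eta> \<sim>\<^sub>n one_on T22"
proof -
  have T: "T22 = {{1,2}, {1,3}, {1,4}, {1,5}, {1,6}, {1,7}, {2,3}, {2,6}, {3,5}, {5,6}}"
    by (simp add: T22_def P_def insert_commute)
  have "\<forall>t\<in>T22. \<eta> t \<noteq> 0" using supp by (auto simp: support_def)
  then have [simp]: "\<eta> {1,2} \<noteq> 0" "\<eta> {1,3} \<noteq> 0" "\<eta> {1,4} \<noteq> 0" "\<eta> {1,5} \<noteq> 0" "\<eta> {2,3} \<noteq> 0"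
    by (simp_all add: T)
  have rel: "\<eta> {1,7} * \<eta> {2,3} = \<eta> {2,6} * \<eta> {1,3}" "\<eta> {2,6} * \<eta> {1,3} = \<eta> {3,5} * \<eta> {1,2}"
    "\<eta> {1,4} * \<eta> {2,6} = \<eta> {2,3} * \<eta> {1,6}" "\<eta> {2,3} * \<eta> {1,6} = \<eta> {5,6} * \<eta> {1,2}"
    "\<eta> {2,3} * \<eta> {1,5} = \<eta> {5,6} * \<eta> {1,3}"
    using A_rotate [OF A, of 1 2 3] A_rotate [OF A, of 2 3 1] A_rotate [OF A, of 1 2 6]
      A_rotate [OF A, of 2 6 1] A_rotate [OF A, of 3 5 1]
    by (simp_all add: generative_def I_eq insert_commute)
  \<comment> \<open>In this order the relations are triangular: each determines one new value from
    those already known.\<close>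
  have 56: "\<eta> {5,6} = \<eta> {1,5} * \<eta> {2,3} / \<eta> {1,3}"
    using rel(5) by (simp add: field_simps)
  have 16: "\<eta> {1,6} = \<eta> {1,2} * \<eta> {1,5} / \<eta> {1,3}"
    using rel(4) by (simp add: 56 field_simps)
  have 26: "\<eta> {2,6} = \<eta> {1,2} * \<eta> {1,5} * \<eta> {2,3} / (\<eta> {1,3} * \<eta> {1,4})"
    using rel(3) by (simp add: 16 field_simps)
  have 17: "\<eta> {1,7} = \<eta> {1,2} * \<eta> {1,5} / \<eta> {1,4}"
    using rel(1) by (simp add: 26 field_simps)
  have 35: "\<eta> {3,5} = \<eta> {1,5} * \<eta> {2,3} / \<eta> {1,4}"
    using rel(2) by (simp add: 26 field_simps)
  obtain r where r: "r \<noteq> 0" "\<eta> {1,5} = r\<^sup>2 / \<eta> {1,2}"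
    using square_over [of "\<eta> {1,2}" "\<eta> {1,5}"] by auto
  show ?thesis
    by (rule norm_equiv_one_on_edgesI [OF A supp, where
          E = "{(1,2), (1,3), (1,4), (1,5), (1,6), (1,7), (2,3), (2,6), (3,5), (5,6)}"
          and \<alpha> = "(\<lambda>_. 1)(1 := 1 / r,
          4 := \<eta> {2,3} * r / \<eta> {1,4}, 5 := \<eta> {1,2} / r, 6 := \<eta> {1,3} / r, 7 := \<eta> {2,3})"])
      (simp_all add: r T 56 16 26 17 35 field_simps power2_eq_square)
qed

lemma norm_equiv_T23:
  assumes A: "\<eta> \<in> \<A>" and supp: "support \<eta> = T23"
  shows "\<eta> \<sim>\<^sub>n one_on T23"
proof -
  \<comment> \<open>The complement is made explicit by running through all pairs of points.\<close>
  have T: "T23 = {{1,2}, {1,3}, {1,4}, {1,5}, {1,6}, {1,7}, {2,3}, {2,4}, {2,5}, {2,6}, {2,7},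
      {3,5}, {4,5}, {5,6}, {5,7}}" (is "_ = ?E")
  proof
    have edge: "{i, j} \<in> ?E" if "i \<in> I" "j \<in> I" "i \<noteq> j" "{i, j} \<notin> T19" for i j
      using that unfolding I_eq T19_def
      by (elim insertE emptyE; simp add: doubleton_eq_iff)
    show "T23 \<subseteq> ?E"
    proof
      fix t assume "t \<in> T23"
      then obtain i j where "t = {i, j}" "i \<in> I" "j \<in> I" "i \<noteq> j" "t \<notin> T19"
        unfolding T23_def X_def by blast
      then show "t \<in> ?E" using edge [of i j] by simp
    qed
    show "?E \<subseteq> T23" by (simp add: T23_def T19_def I_eq doubleton_eq_iff)
  qed
  have "\<forall>t\<in>T23. \<eta> t \<noteq> 0" using supp by (auto simp: support_def)
  then have [simp]: "\<eta> {1,2} \<noteq> 0" "\<eta> {1,3} \<noteq> 0" "\<eta> {1,4} \<noteq> 0" "\<eta> {1,5} \<noteq> 0" "\<eta> {2,3} \<noteq> 0"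
    "\<eta> {2,5} \<noteq> 0"
    by (simp_all add: T)
  have rel: "\<eta> {1,7} * \<eta> {2,3} = \<eta> {2,6} * \<eta> {1,3}" "\<eta> {2,6} * \<eta> {1,3} = \<eta> {3,5} * \<eta> {1,2}"
    "\<eta> {1,4} * \<eta> {2,6} = \<eta> {2,3} * \<eta> {1,6}" "\<eta> {2,3} * \<eta> {1,6} = \<eta> {5,6} * \<eta> {1,2}"
    "\<eta> {2,3} * \<eta> {1,5} = \<eta> {5,6} * \<eta> {1,3}" "\<eta> {2,4} * \<eta> {3,5} = \<eta> {1,3} * \<eta> {2,5}"
    "\<eta> {1,3} * \<eta> {2,5} = \<eta> {5,7} * \<eta> {2,3}" "\<eta> {5,7} * \<eta> {1,2} = \<eta> {1,3} * \<eta> {2,7}"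
    "\<eta> {2,7} * \<eta> {1,4} = \<eta> {4,5} * \<eta> {1,2}"
    using A_rotate [OF A, of 1 2 3] A_rotate [OF A, of 2 3 1] A_rotate [OF A, of 1 2 6]
      A_rotate [OF A, of 2 6 1] A_rotate [OF A, of 3 5 1] A_rotate [OF A, of 2 3 5]
      A_rotate [OF A, of 3 5 2] A_rotate [OF A, of 7 1 2] A_rotate [OF A, of 2 4 1]
    by (simp_all add: generative_def I_eq insert_commute)
  have 56: "\<eta> {5,6} = \<eta> {1,5} * \<eta> {2,3} / \<eta> {1,3}"
    using rel(5) by (simp add: field_simps)
  have 16: "\<eta> {1,6} = \<eta> {1,2} * \<eta> {1,5} / \<eta> {1,3}"
    using rel(4) by (simp add: 56 field_simps)
  have 26: "\<eta> {2,6} = \<eta> {1,2} * \<eta> {1,5} * \<eta> {2,3} / (\<eta> {1,3} * \<eta> {1,4})"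
    using rel(3) by (simp add: 16 field_simps)
  have 17: "\<eta> {1,7} = \<eta> {1,2} * \<eta> {1,5} / \<eta> {1,4}"
    using rel(1) by (simp add: 26 field_simps)
  have 35: "\<eta> {3,5} = \<eta> {1,5} * \<eta> {2,3} / \<eta> {1,4}"
    using rel(2) by (simp add: 26 field_simps)
  \<comment> \<open>The first five relations are those used for \<open>T22\<close>; the last four
    add the edges whose values involve the sixth free value \<open>\<eta> {2,5}\<close>.\<close>
  have 24: "\<eta> {2,4} = \<eta> {1,3} * \<eta> {1,4} * \<eta> {2,5} / (\<eta> {1,5} * \<eta> {2,3})"
    using rel(6) by (simp add: 35 field_simps)
  have 57: "\<eta> {5,7} = \<eta> {1,3} * \<eta> {2,5} / \<eta> {2,3}"
    using rel(7) by (simp add: field_simps)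
  have 27: "\<eta> {2,7} = \<eta> {1,2} * \<eta> {2,5} / \<eta> {2,3}"
    using rel(8) by (simp add: 57 field_simps)
  have 45: "\<eta> {4,5} = \<eta> {1,4} * \<eta> {2,5} / \<eta> {2,3}"
    using rel(9) by (simp add: 27 field_simps)
  obtain r where r: "r \<noteq> 0" "\<eta> {1,5} = r\<^sup>2 / \<eta> {1,2}"
    using square_over [of "\<eta> {1,2}" "\<eta> {1,5}"] by auto
  obtain s where s: "s \<noteq> 0" "\<eta> {2,5} = s\<^sup>2 / \<eta> {1,2}"
    using square_over [of "\<eta> {1,2}" "\<eta> {2,5}"] by auto
  show ?thesis
    by (rule norm_equiv_one_on_edgesI [OF A supp, where
          E = "{(1,2), (1,3), (1,4), (1,5), (1,6), (1,7), (2,3), (2,4), (2,5), (2,6),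
            (2,7), (3,5), (4,5), (5,6), (5,7)}"
          and \<alpha> = "(\<lambda>_. 1)(1 := 1 / r, 2 := 1 / s,
          4 := \<eta> {2,3} * r / (s * \<eta> {1,4}), 5 := \<eta> {1,2} / (r * s), 6 := \<eta> {1,3} / r,
          7 := \<eta> {2,3} / s)"])
      (simp_all add: r s T 56 16 26 17 35 24 57 27 45
         field_simps power2_eq_square)
qed

subsection \<open>Supports through the point \<open>1\<close>\<close>

lemma T20_eq: "T20 = {{1,2}, {1,3}, {1,4}, {1,5}, {1,6}, {1,7}}"
proof -
  have "{j. 2 \<le> j \<and> j \<le> 7} = {2, 3, 4, 5, 6, 7::nat}" by auto
  then have "T20 = (\<lambda>j. {1, j}) ` {2, 3, 4, 5, 6, 7}" unfolding T20_def by auto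
  then show ?thesis by simp
qed

text \<open>All relations of \<open>\<A>\<close> are trivial here: if both factors of a triple \<open>i\<close>, \<open>j\<close>, \<open>k\<close> were
  nonzero, then \<open>1\<close> would lie in both \<open>{i, j \<star> k}\<close> and \<open>{j, k}\<close>.\<close>

lemma A_if_support_T20:
  assumes "\<eta> \<in> X \<rightarrow>\<^sub>E UNIV" "support \<eta> \<subseteq> T20"
  shows "\<eta> \<in> \<A>"
proof -
  have zero: "\<eta> {i, j} = 0" if "i \<in> I" "j \<in> I" "i \<noteq> j" "1 \<notin> {i, j}" for i j
  proof -
    have "{i, j} \<notin> T20" using that(4) by (auto simp: T20_def)
    with assms(2) have "{i, j} \<notin> support \<eta>" by blast
    with that show ?thesis by (simp add: support_def)
  qed
  have "triple \<eta> i j k = 0" if gen: "generative i j k" for i j k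
  proof (cases "1 \<in> {j, k}")
    case True
    then have "1 \<noteq> i" "1 \<noteq> j \<star> k"
      using gen star_left_neq [of j k] star_left_neq [of k j] star_commute [of j k]
      by (auto simp: generative_def)
    then show ?thesis
      using zero [of i "j \<star> k"] gen generative_neq [OF gen] star_in_I [of j k]
      by (simp add: triple_def generative_def)
  next
    case False
    then show ?thesis using zero [of j k] gen by (simp add: triple_def generative_def)
  qed
  then have "triple \<eta> i j k = triple \<eta> j k i" if "generative i j k" for i j k
    using that generative_rotate [OF that] by simp
  then show ?thesis using assms(1) unfolding \<A>_def by blast
qed

text \<open>On edges through \<open>1\<close>, \<alpha> enters only via
  \<open>a = \<alpha> 1\<close> and its ratios \<open>b\<close>, \<open>c\<close>, \<open>d\<close>
  of the two further points on the lines \<open>{1,2,5}\<close>, \<open>{1,3,6}\<close>,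
  \<open>{1,4,7}\<close>.\<close>

lemma norm_equiv_T20_iff:
  assumes "\<eta> \<in> X \<rightarrow>\<^sub>E UNIV" "support \<eta> \<subseteq> T20" "\<eta>' \<in> X \<rightarrow>\<^sub>E UNIV" "support \<eta>' \<subseteq> T20"
  shows "\<eta> \<sim>\<^sub>n \<eta>' \<longleftrightarrow> (\<exists>a b c d. a \<noteq> 0 \<and> b \<noteq> 0 \<and> c \<noteq> 0 \<and> d \<noteq> 0 \<and>
    \<eta>' {1,2} = \<eta> {1,2} * a * b \<and> \<eta>' {1,5} = \<eta> {1,5} * a / b \<and>
    \<eta>' {1,3} = \<eta> {1,3} * a * c \<and> \<eta>' {1,6} = \<eta> {1,6} * a / c \<and>
    \<eta>' {1,4} = \<eta> {1,4} * a * d \<and> \<eta>' {1,7} = \<eta> {1,7} * a / d)"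
    (is "_ \<longleftrightarrow> ?R")
proof
  assume "\<eta> \<sim>\<^sub>n \<eta>'"
  then obtain \<alpha> where nz: "\<forall>i\<in>I. \<alpha> i \<noteq> 0"
    and "\<forall>i\<in>I. \<forall>j\<in>I. i \<noteq> j \<longrightarrow> \<eta>' {i, j} = \<eta> {i, j} * (\<alpha> i * \<alpha> j / \<alpha> (i \<star> j))"
    unfolding norm_equiv_def by blast
  then have "\<eta>' {1, j} = \<eta> {1, j} * (\<alpha> 1 * \<alpha> j / \<alpha> (1 \<star> j))" if "j \<in> I" "j \<noteq> 1" for j
    using that by (auto simp: I_eq)
  then have "\<eta>' {1,2} = \<eta> {1,2} * (\<alpha> 1 * \<alpha> 2 / \<alpha> 5)" "\<eta>' {1,5} = \<eta> {1,5} * (\<alpha> 1 * \<alpha> 5 / \<alpha> 2)"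
    "\<eta>' {1,3} = \<eta> {1,3} * (\<alpha> 1 * \<alpha> 3 / \<alpha> 6)" "\<eta>' {1,6} = \<eta> {1,6} * (\<alpha> 1 * \<alpha> 6 / \<alpha> 3)"
    "\<eta>' {1,4} = \<eta> {1,4} * (\<alpha> 1 * \<alpha> 4 / \<alpha> 7)" "\<eta>' {1,7} = \<eta> {1,7} * (\<alpha> 1 * \<alpha> 7 / \<alpha> 4)"
    by (simp_all add: I_eq)
  then show ?R
    using nz
    by (intro exI [of _ "\<alpha> 1"] exI [of _ "\<alpha> 2 / \<alpha> 5"] exI [of _ "\<alpha> 3 / \<alpha> 6"]
        exI [of _ "\<alpha> 4 / \<alpha> 7"]) (simp add: I_eq)
next
  assume ?R
  then obtain a b c d where
    "a \<noteq> 0" "b \<noteq> 0" "c \<noteq> 0" "d \<noteq> 0"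
    "\<eta>' {1,2} = \<eta> {1,2} * a * b" "\<eta>' {1,5} = \<eta> {1,5} * a / b"
    "\<eta>' {1,3} = \<eta> {1,3} * a * c" "\<eta>' {1,6} = \<eta> {1,6} * a / c"
    "\<eta>' {1,4} = \<eta> {1,4} * a * d" "\<eta>' {1,7} = \<eta> {1,7} * a / d"
    by blast
  then show "\<eta> \<sim>\<^sub>n \<eta>'"
    by (intro norm_equiv_edgesI [where \<alpha> = "(\<lambda>_. 1)(1 := a, 2 := b, 3 := c, 4 := d)"
          and T = T20 and E = "{(1,2), (1,3), (1,4), (1,5), (1,6), (1,7)}"] A_if_support_T20 assms)
      (simp_all add: T20_eq)
qed

section \<open>Tuples as maps on \<open>X\<close>\<close>

lemma tuple_extensional: "tuple T cs \<in> X \<rightarrow>\<^sub>E UNIV"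
  by (simp add: tuple_def)

text \<open>Entries of \<open>cs\<close> may be zero, so this is only an inclusion; it is what
  \<open>norm_equiv_T20_iff\<close> asks for.\<close>

lemma support_tuple_subset: "support (tuple T cs) \<subseteq> T"
proof
  fix t assume "t \<in> support (tuple T cs)"
  then obtain c where "map_of (zip (lex_list T) cs) t = Some c"
    by (auto simp: support_def tuple_def split: option.splits)
  then have "t \<in> set (lex_list T)"
    by (meson map_of_SomeD set_zip_leftD)
  then show "t \<in> T" by (auto simp: lex_list_def split: if_splits)
qed

lemma upt_8: "[1..<8] = [1, 2, 3, 4, 5, 6, 7]" "[2..<8] = [2, 3, 4, 5, 6, 7]"
  "[3..<8] = [3, 4, 5, 6, 7]" "[4..<8] = [4, 5, 6, 7]" "[5..<8] = [5, 6, 7]" "[6..<8] = [6, 7]"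
  "[7..<8] = [7]" "[8..<8] = []"
  by (simp_all add: upt_rec)

lemma lex_list_T14: "lex_list T14 = [{1,2}, {1,3}, {1,5}, {1,6}]"
  by (simp add: lex_list_def upt_8 T14_def doubleton_eq_iff)

lemma lex_list_T17: "lex_list T17 = [{1,2}, {1,3}, {1,4}, {1,5}, {1,6}]"
  by (simp add: lex_list_def upt_8 T17_def doubleton_eq_iff)

lemma lex_list_T20: "lex_list T20 = [{1,2}, {1,3}, {1,4}, {1,5}, {1,6}, {1,7}]"
  by (simp add: lex_list_def upt_8 T20_eq doubleton_eq_iff)

lemma tuple_T14:
  "tuple T14 [x, y, z, w] {1,2} = x" "tuple T14 [x, y, z, w] {1,3} = y"
  "tuple T14 [x, y, z, w] {1,4} = 0" "tuple T14 [x, y, z, w] {1,5} = z"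
  "tuple T14 [x, y, z, w] {1,6} = w" "tuple T14 [x, y, z, w] {1,7} = 0"
  by (simp_all add: tuple_def lex_list_T14 I_eq doubleton_eq_iff)

lemma tuple_T17:
  "tuple T17 [x, y, z, w, v] {1,2} = x" "tuple T17 [x, y, z, w, v] {1,3} = y"
  "tuple T17 [x, y, z, w, v] {1,4} = z" "tuple T17 [x, y, z, w, v] {1,5} = w"
  "tuple T17 [x, y, z, w, v] {1,6} = v" "tuple T17 [x, y, z, w, v] {1,7} = 0"
  by (simp_all add: tuple_def lex_list_T17 I_eq doubleton_eq_iff)

lemma tuple_T20:
  "tuple T20 [x, y, z, w, v, u] {1,2} = x" "tuple T20 [x, y, z, w, v, u] {1,3} = y"
  "tuple T20 [x, y, z, w, v, u] {1,4} = z" "tuple T20 [x, y, z, w, v, u] {1,5} = w"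
  "tuple T20 [x, y, z, w, v, u] {1,6} = v" "tuple T20 [x, y, z, w, v, u] {1,7} = u"
  by (simp_all add: tuple_def lex_list_T20 I_eq doubleton_eq_iff)

lemma T14_subset_T20: "T14 \<subseteq> T20" and T17_subset_T20: "T17 \<subseteq> T20"
  by (simp_all add: T14_def T17_def T20_eq)

lemma norm_equiv_tuple_iff:
  assumes "\<eta> \<in> \<A>" "support \<eta> = T" "T \<subseteq> T20"
  shows "\<eta> \<sim>\<^sub>n tuple T cs \<longleftrightarrow> (\<exists>a b c d. a \<noteq> 0 \<and> b \<noteq> 0 \<and> c \<noteq> 0 \<and> d \<noteq> 0 \<and>
    tuple T cs {1,2} = \<eta> {1,2} * a * b \<and> tuple T cs {1,5} = \<eta> {1,5} * a / b \<and>
    tuple T cs {1,3} = \<eta> {1,3} * a * c \<and> tuple T cs {1,6} = \<eta> {1,6} * a / c \<and>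
    tuple T cs {1,4} = \<eta> {1,4} * a * d \<and> tuple T cs {1,7} = \<eta> {1,7} * a / d)"
  using assms support_tuple_subset [of T cs]
  by (intro norm_equiv_T20_iff tuple_extensional) (auto simp: \<A>_def)

lemma tuple_norm_equiv_tuple_iff:
  assumes "T \<subseteq> T20"
  shows "tuple T cs \<sim>\<^sub>n tuple T cs' \<longleftrightarrow> (\<exists>a b c d. a \<noteq> 0 \<and> b \<noteq> 0 \<and> c \<noteq> 0 \<and> d \<noteq> 0 \<and>
    tuple T cs' {1,2} = tuple T cs {1,2} * a * b \<and> tuple T cs' {1,5} = tuple T cs {1,5} * a / b \<and>
    tuple T cs' {1,3} = tuple T cs {1,3} * a * c \<and> tuple T cs' {1,6} = tuple T cs {1,6} * a / c \<and>
    tuple T cs' {1,4} = tuple T cs {1,4} * a * d \<and> tuple T cs' {1,7} = tuple T cs {1,7} * a / d)"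
  using assms support_tuple_subset [of T cs] support_tuple_subset [of T cs']
  by (intro norm_equiv_T20_iff tuple_extensional) auto

section \<open>Reaching the normal forms\<close>

lemma norm_equiv_T14:
  assumes A: "\<eta> \<in> \<A>" and supp: "support \<eta> = T14"
    and l: "l = \<eta> {1,3} * \<eta> {1,6} / (\<eta> {1,2} * \<eta> {1,5})"
  shows "\<eta> \<sim>\<^sub>n tuple T14 [1, 1, 1, l]"
proof -
  have "\<forall>t\<in>T14. \<eta> t \<noteq> 0" using supp by (auto simp: support_def)
  then have [simp]: "\<eta> {1,2} \<noteq> 0" "\<eta> {1,3} \<noteq> 0" "\<eta> {1,5} \<noteq> 0" "\<eta> {1,6} \<noteq> 0"
    by (simp_all add: T14_def)
  have "{1,4} \<notin> support \<eta>" "{1,7} \<notin> support \<eta>"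
    by (simp_all add: supp T14_def doubleton_eq_iff)
  then have [simp]: "\<eta> {1,4} = 0" "\<eta> {1,7} = 0"
    by (simp_all add: support_def I_eq)
  obtain r where r: "r \<noteq> 0" "\<eta> {1,5} = r\<^sup>2 / \<eta> {1,2}"
    using square_over [of "\<eta> {1,2}" "\<eta> {1,5}"] by auto
  show ?thesis
    unfolding norm_equiv_tuple_iff [OF A supp T14_subset_T20] tuple_T14
    using r l
    \<comment> \<open>The choices of \<open>a\<close> and \<open>b\<close> give \<open>1\<close> at
      \<open>{1,2}\<close> and \<open>{1,5}\<close>, and \<open>c\<close> gives \<open>1\<close> at
      \<open>{1,3}\<close>, which leaves \<open>l\<close> at \<open>{1,6}\<close>. The value of
      \<open>d\<close> is arbitrary because \<open>\<eta>\<close> vanishes on \<open>{1,4}\<close>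
      and \<open>{1,7}\<close>.\<close>
    by (intro exI [of _ "1 / r"] exI [of _ "r / \<eta> {1,2}"] exI [of _ "r / \<eta> {1,3}"]
        exI [of _ 1])
      (simp add: field_simps power2_eq_square)
qed

lemma norm_equiv_T17:
  assumes A: "\<eta> \<in> \<A>" and supp: "support \<eta> = T17"
    and l: "l\<^sup>2 = \<eta> {1,3} * \<eta> {1,6} / (\<eta> {1,2} * \<eta> {1,5})"
  shows "\<eta> \<sim>\<^sub>n tuple T17 [1, l, 1, 1, l]"
proof -
  have "\<forall>t\<in>T17. \<eta> t \<noteq> 0" using supp by (auto simp: support_def)
  then have [simp]: "\<eta> {1,2} \<noteq> 0" "\<eta> {1,3} \<noteq> 0" "\<eta> {1,4} \<noteq> 0" "\<eta> {1,5} \<noteq> 0" "\<eta> {1,6} \<noteq> 0"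
    by (simp_all add: T17_def)
  have "{1,7} \<notin> support \<eta>"
    by (simp add: supp T17_def doubleton_eq_iff)
  then have [simp]: "\<eta> {1,7} = 0"
    by (simp add: support_def I_eq)
  have "l \<noteq> 0" using l by auto
  have 16: "\<eta> {1,6} = l\<^sup>2 * \<eta> {1,2} * \<eta> {1,5} / \<eta> {1,3}"
    using l by (simp add: field_simps)
  obtain r where r: "r \<noteq> 0" "\<eta> {1,5} = r\<^sup>2 / \<eta> {1,2}"
    using square_over [of "\<eta> {1,2}" "\<eta> {1,5}"] by auto
  show ?thesis
    unfolding norm_equiv_tuple_iff [OF A supp T17_subset_T20] tuple_T17
    using r \<open>l \<noteq> 0\<close>
    \<comment> \<open>The factor \<open>l\<close> in \<open>c\<close> splits the product
      \<open>l\<^sup>2\<close> on the line \<open>{1,3,6}\<close> evenly between its two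
      edges.\<close>
    by (intro exI [of _ "1 / r"] exI [of _ "r / \<eta> {1,2}"] exI [of _ "l * r / \<eta> {1,3}"]
        exI [of _ "r / \<eta> {1,4}"])
      (simp add: 16 field_simps power2_eq_square)
qed

lemma norm_equiv_T20:
  assumes A: "\<eta> \<in> \<A>" and supp: "support \<eta> = T20"
    and l: "l\<^sup>2 = \<eta> {1,3} * \<eta> {1,6} / (\<eta> {1,2} * \<eta> {1,5})"
    and m: "m\<^sup>2 = \<eta> {1,4} * \<eta> {1,7} / (\<eta> {1,2} * \<eta> {1,5})"
  shows "\<eta> \<sim>\<^sub>n tuple T20 [1, l, m, 1, l, m]"
proof -
  have "\<forall>t\<in>T20. \<eta> t \<noteq> 0" using supp by (auto simp: support_def)
  then have [simp]: "\<eta> {1,2} \<noteq> 0" "\<eta> {1,3} \<noteq> 0" "\<eta> {1,4} \<noteq> 0" "\<eta> {1,5} \<noteq> 0" "\<eta> {1,6} \<noteq> 0"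
    "\<eta> {1,7} \<noteq> 0"
    by (simp_all add: T20_eq)
  have "l \<noteq> 0" "m \<noteq> 0" using l m by auto
  have 16: "\<eta> {1,6} = l\<^sup>2 * \<eta> {1,2} * \<eta> {1,5} / \<eta> {1,3}"
    using l by (simp add: field_simps)
  have 17: "\<eta> {1,7} = m\<^sup>2 * \<eta> {1,2} * \<eta> {1,5} / \<eta> {1,4}"
    using m by (simp add: field_simps)
  obtain r where r: "r \<noteq> 0" "\<eta> {1,5} = r\<^sup>2 / \<eta> {1,2}"
    using square_over [of "\<eta> {1,2}" "\<eta> {1,5}"] by auto
  show ?thesis
    unfolding norm_equiv_tuple_iff [OF A supp subset_refl] tuple_T20
    using r \<open>l \<noteq> 0\<close> \<open>m \<noteq> 0\<close>
    by (intro exI [of _ "1 / r"] exI [of _ "r / \<eta> {1,2}"] exI [of _ "l * r / \<eta> {1,3}"]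
        exI [of _ "m * r / \<eta> {1,4}"])
      (simp add: 16 17 field_simps power2_eq_square)
qed

section \<open>Uniqueness of the parameters\<close>

text \<open>The three entries \<open>1\<close> force \<open>a = b = c\<close>, so the factor
  \<open>a / c\<close> at \<open>{1,6}\<close> is \<open>1\<close>.\<close>

lemma tuple_T14_equiv_iff:
  "tuple T14 [1, 1, 1, l] \<sim>\<^sub>n tuple T14 [1, 1, 1, l'] \<longleftrightarrow> l = l'"
  unfolding tuple_norm_equiv_tuple_iff [OF T14_subset_T20] tuple_T14
proof (intro iffI)
  assume "l = l'"
  then show "\<exists>a b c d. a \<noteq> 0 \<and> b \<noteq> 0 \<and> c \<noteq> 0 \<and> d \<noteq> 0 \<and> 1 = 1 * a * b \<and> 1 = 1 * a / b \<and>
      1 = 1 * a * c \<and> l' = l * a / c \<and> 0 = 0 * a * d \<and> 0 = 0 * a / d"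
    by (intro exI [of _ 1]) simp
next
  assume "\<exists>a b c d. a \<noteq> 0 \<and> b \<noteq> 0 \<and> c \<noteq> 0 \<and> d \<noteq> 0 \<and> 1 = 1 * a * b \<and> 1 = 1 * a / b \<and>
      1 = 1 * a * c \<and> l' = l * a / c \<and> 0 = 0 * a * d \<and> 0 = 0 * a / d"
  then obtain a b c where *: "a \<noteq> 0" "b \<noteq> 0" "a * b = 1" "1 = a / b" "a * c = 1" "l' = l * a / c"
    by auto
  then have "b = c" by (metis mult_left_cancel)
  moreover have "a = b" using *(2,4) by (simp add: field_simps)
  ultimately show "l = l'" using * by simp
qed

text \<open>The line \<open>{1,2,5}\<close> forces \<open>a\<^sup>2 = 1\<close>. On another line the
  product of the two entries is scaled by \<open>a\<^sup>2\<close>, so \<open>l\<^sup>2\<close> is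
  invariant.\<close>

lemma scaled_pair_sign:
  fixes a b c l l' :: complex
  assumes "c \<noteq> 0" "1 = 1 * a * b" "1 = 1 * a / b" "l' = l * a * c" "l' = l * a / c"
  shows "l = l' \<or> l = - l'"
proof -
  have "b \<noteq> 0" using assms(2) by auto
  then have "a = b" using assms(3) by (simp add: field_simps)
  then have "a * a = 1" using assms(2) by simp
  have "l' * l' = (l * a * c) * (l * a / c)" using assms(4,5) by metis
  also have "\<dots> = l * l * (a * a)" using assms(1) by simp
  finally show ?thesis using \<open>a * a = 1\<close> by (metis mult.right_neutral square_eq_iff)
qed

lemma tuple_T17_equiv_iff:
  "tuple T17 [1, l, 1, 1, l] \<sim>\<^sub>n tuple T17 [1, l', 1, 1, l'] \<longleftrightarrow> l = l' \<or> l = - l'"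
  unfolding tuple_norm_equiv_tuple_iff [OF T17_subset_T20] tuple_T17
proof (intro iffI)
  assume "l = l' \<or> l = - l'"
  then show "\<exists>a b c d. a \<noteq> 0 \<and> b \<noteq> 0 \<and> c \<noteq> 0 \<and> d \<noteq> 0 \<and> 1 = 1 * a * b \<and> 1 = 1 * a / b \<and>
      l' = l * a * c \<and> l' = l * a / c \<and> 1 = 1 * a * d \<and> 0 = 0 * a / d"
    \<comment> \<open>A change of sign is realised by \<open>c = -1\<close> with the other
      parameters equal to \<open>1\<close>.\<close>
    by (intro exI [of _ 1] exI [of _ "if l = l' then 1 else -1"]) auto
qed (elim exE conjE, rule scaled_pair_sign, assumption+)

lemma tuple_T20_equiv_iff:
  "tuple T20 [1, l, m, 1, l, m] \<sim>\<^sub>n tuple T20 [1, l', m', 1, l', m'] \<longleftrightarrow>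
    (l = l' \<or> l = - l') \<and> (m = m' \<or> m = - m')"
  unfolding tuple_norm_equiv_tuple_iff [OF subset_refl] tuple_T20
proof (intro iffI)
  assume "(l = l' \<or> l = - l') \<and> (m = m' \<or> m = - m')"
  then show "\<exists>a b c d. a \<noteq> 0 \<and> b \<noteq> 0 \<and> c \<noteq> 0 \<and> d \<noteq> 0 \<and> 1 = 1 * a * b \<and> 1 = 1 * a / b \<and>
      l' = l * a * c \<and> l' = l * a / c \<and> m' = m * a * d \<and> m' = m * a / d"
    by (intro exI [of _ 1] exI [of _ "if l = l' then 1 else -1"]
        exI [of _ "if m = m' then 1 else -1"]) auto
next
  assume "\<exists>a b c d. a \<noteq> 0 \<and> b \<noteq> 0 \<and> c \<noteq> 0 \<and> d \<noteq> 0 \<and> 1 = 1 * a * b \<and> 1 = 1 * a / b \<and>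
      l' = l * a * c \<and> l' = l * a / c \<and> m' = m * a * d \<and> m' = m * a / d"
  then show "(l = l' \<or> l = - l') \<and> (m = m' \<or> m = - m')"
    by (elim exE conjE, intro conjI) (rule scaled_pair_sign, assumption+)+
qed

section \<open>Collecting the supports with normal form \<open>1\<close>\<close>

lemma norm_equiv_one_on:
  assumes A: "\<eta> \<in> \<A>" and supp: "support \<eta> = T"
    and T: "T \<in> {T2, T3, T4, T5, T6, T7, T8, T9, T10, T11, T12, T13, T14, T15, T16, T17, T18, T19, T20,
      T21, T22, T23}" "T \<notin> {T14, T17, T20}"
  shows "\<eta> \<sim>\<^sub>n one_on T"
proof -
  \<comment> \<open>These nine sets inherit the result from \<open>T13\<close>, \<open>T16\<close>
    or \<open>T18\<close>.\<close>
  have "T2 \<subseteq> T13" "T3 \<subseteq> T13" "T4 \<subseteq> T13" "T5 \<subseteq> T16" "T8 \<subseteq> T13" "T9 \<subseteq> T13" "T11 \<subseteq> T18"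
    "T12 \<subseteq> T16" "T15 \<subseteq> T18"
    by (simp_all add: T2_def T3_def T4_def T5_def T8_def T9_def T11_def T12_def T13_def T15_def
        T16_def T18_def)
  then have "T \<in> {T21, T22, T23} \<or> (\<exists>T'\<in>{T6, T7, T10, T13, T16, T18, T19}. T \<subseteq> T')"
    using T by (elim insertE emptyE; simp)
  then show ?thesis
  proof (elim disjE bexE)
    assume "T \<in> {T21, T22, T23}"
    then show ?thesis
      using supp norm_equiv_T21 [OF A] norm_equiv_T22 [OF A] norm_equiv_T23 [OF A] by auto
  next
    fix T' assume "T' \<in> {T6, T7, T10, T13, T16, T18, T19}" "T \<subseteq> T'"
    moreover have "normalizable T'"
      using calculation(1) normalizable_T6 normalizable_T7 normalizable_T10 normalizable_T13
        normalizable_T16 normalizable_T18 normalizable_T19 by auto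
    ultimately show ?thesis using normalizable_norm_equiv [of T' \<eta>] A supp by simp
  qed
qed

theorem theorem4p1:
  shows
    "(\<forall>\<eta> \<in> \<A>. \<forall>T \<in> {T2, T3, T4, T5, T6, T7, T8, T9, T10, T11, T12, T13, T14, T15, T16, T17, T18,
          T19, T20, T21, T22, T23}.
        support \<eta> = T \<longrightarrow> T \<notin> {T14, T17, T20} \<longrightarrow> \<eta> \<sim>\<^sub>n one_on T) \<and>
     ((\<forall>\<eta> \<in> \<A>. support \<eta> = T14 \<longrightarrow>
         (\<forall>l. l = \<eta> {1,3} * \<eta> {1,6} / (\<eta> {1,2} * \<eta> {1,5}) \<longrightarrow> \<eta> \<sim>\<^sub>n tuple T14 [1, 1, 1, l])) \<and>
      (\<forall>l l'. l \<noteq> 0 \<longrightarrow> l' \<noteq> 0 \<longrightarrow>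
         (tuple T14 [1, 1, 1, l] \<sim>\<^sub>n tuple T14 [1, 1, 1, l'] \<longleftrightarrow> l = l'))) \<and>
     ((\<forall>\<eta> \<in> \<A>. support \<eta> = T17 \<longrightarrow>
         (\<forall>l. l\<^sup>2 = \<eta> {1,3} * \<eta> {1,6} / (\<eta> {1,2} * \<eta> {1,5}) \<longrightarrow> \<eta> \<sim>\<^sub>n tuple T17 [1, l, 1, 1, l])) \<and>
      (\<forall>l l'. l \<noteq> 0 \<longrightarrow> l' \<noteq> 0 \<longrightarrow>
         (tuple T17 [1, l, 1, 1, l] \<sim>\<^sub>n tuple T17 [1, l', 1, 1, l'] \<longleftrightarrow> l = l' \<or> l = - l'))) \<and>
     ((\<forall>\<eta> \<in> \<A>. support \<eta> = T20 \<longrightarrow>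
         (\<forall>l m. l\<^sup>2 = \<eta> {1,3} * \<eta> {1,6} / (\<eta> {1,2} * \<eta> {1,5}) \<longrightarrow>
                m\<^sup>2 = \<eta> {1,4} * \<eta> {1,7} / (\<eta> {1,2} * \<eta> {1,5}) \<longrightarrow>
                \<eta> \<sim>\<^sub>n tuple T20 [1, l, m, 1, l, m])) \<and>
      (\<forall>l m l' m'. l \<noteq> 0 \<longrightarrow> m \<noteq> 0 \<longrightarrow> l' \<noteq> 0 \<longrightarrow> m' \<noteq> 0 \<longrightarrow>
         (tuple T20 [1, l, m, 1, l, m] \<sim>\<^sub>n tuple T20 [1, l', m', 1, l', m'] \<longleftrightarrow>
            (l = l' \<or> l = - l') \<and> (m = m' \<or> m = - m'))))"
  apply (intro conjI ballI allI impI)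
  subgoal by (rule norm_equiv_one_on)
  subgoal by (rule norm_equiv_T14)
  subgoal by (rule tuple_T14_equiv_iff)
  subgoal by (rule norm_equiv_T17)
  subgoal by (rule tuple_T17_equiv_iff)
  subgoal by (rule norm_equiv_T20)
  subgoal by (rule tuple_T20_equiv_iff)
  done

end
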